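(* Let $n\ge 4$ and suppose Tic-Tac-Toe is played on an atomic transversal design $\mathrm{TD}(3,n)$. If Xeno (the first player) plays a score-optimizing strategy, then Ophelia (the second player) can force a draw, by playing a score-optimizing strategy herself.
   Context: A transversal design $\mathrm{TD}(3,n)$ is a triple $(X,\mathcal{G},\mathcal{B})$ where $X$ is a set of $3n$ points, $\mathcal{G}=\{G_1,G_2,G_3\}$ is a partition of $X$ into three groups of cardinality $n$, and $\mathcal{B}$ is a set of 3-element subsets of $X$ (blocks) such that every pair of points not in the same group appears in exactly one block, and no block contains two points of the same group. For a point $x$, $G[x]$ denotes the graph with an edge $ab$ for each block $\{x,a,b\}\in\mathcal{B}$. For distinct points $x,y$ in the same group, $G[x]\cup G[y]$ is a 2-regular graph on the $2n$ points of the other two groups. The design is pan-Hamiltonian with respect to a group $G_i$ if for every pair of distinct points $x,y\in G_i$ the graph $G[x]\cup G[y]$ is a single cycle. It is atomic if it is pan-Hamiltonian with respect to each of $G_1,G_2,G_3$. Tic-Tac-Toe: two players, Xeno (first) and Ophelia (second), alternately choose points not chosen before; the first player to have chosen all the points of some block wins; if all points are chosen and nobody has completed a block, the game is a draw. Only blocks (not groups) are winning sets. Ophelia "can force a draw" if she has a way of playing that guarantees that Xeno does not win. Score-optimizing strategies: at a given state of the game, let $\mathcal{X}$ be the set of points chosen by Xeno and $\mathcal{O}$ the set of points chosen by Ophelia. The weight of a block $h$ is $w(h)=2^{|\mathcal{X}\cap h|-|h|}$ if $h\cap\mathcal{O}=\emptyset$, and $w(h)=0$ otherwise. The weight of a point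 $u$ is $w(u)=\sum_{h\in\mathcal{B}:\,u\in h} w(h)$. A score-optimizing strategy (for either player, using the same weight function $w$) is one in which, on each turn, the player plays a winning move (completing a block) if one exists; otherwise, if the opponent threatens to complete a block on the opponent's next move, plays to block such an immediate win; otherwise chooses an unchosen point of maximum weight, with ties broken by any method. *)

theory Defs
  imports Complex_Main "HOL-Library.Disjoint_Sets"
begin

section \<open>Transversal designs of block size three\<close>

definition transversal_design3 ::
    "nat \<Rightarrow> 'a set \<Rightarrow> 'a set set \<Rightarrow> 'a set set \<Rightarrow> bool" where
  "transversal_design3 n X \<G> \<B> \<longleftrightarrow>
     finite X \<and> card X = 3 * n \<and>
     partition_on X \<G> \<and> card \<G> = 3 \<and> (\<forall>G\<in>\<G>. card G = n) \<and>
     (\<forall>b\<in>\<B>. b \<subseteq> X \<and> card b = 3) \<and>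
     (\<forall>x\<in>X. \<forall>y\<in>X. (\<forall>G\<in>\<G>. \<not> (x \<in> G \<and> y \<in> G)) \<longrightarrow> (\<exists>!b. b \<in> \<B> \<and> x \<in> b \<and> y \<in> b)) \<and>
     (\<forall>b\<in>\<B>. \<forall>G\<in>\<G>. \<forall>x\<in>b \<inter> G. \<forall>y\<in>b \<inter> G. x = y)"

text \<open>The edge set of the graph $G[x]$; an edge is a two-element set of points.\<close>

definition link_edges :: "'a set set \<Rightarrow> 'a \<Rightarrow> 'a set set" where
  "link_edges \<B> x = {{a, b} | a b. {x, a, b} \<in> \<B>}"

text \<open>The simple graph with vertex set \<open>V\<close> and edge set \<open>E\<close> is one cycle through all of \<open>V\<close>.\<close>

definition single_cycle :: "'a set \<Rightarrow> 'a set set \<Rightarrow> bool" where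
  "single_cycle V E \<longleftrightarrow>
     (\<exists>c. distinct c \<and> 3 \<le> length c \<and> set c = V \<and>
          E = {{c ! i, c ! (Suc i mod length c)} | i. i < length c})"

definition pan_Hamiltonian ::
    "'a set \<Rightarrow> 'a set set \<Rightarrow> 'a set \<Rightarrow> bool" where
  "pan_Hamiltonian X \<B> G \<longleftrightarrow>
     (\<forall>x\<in>G. \<forall>y\<in>G. x \<noteq> y \<longrightarrow> single_cycle (X - G) (link_edges \<B> x \<union> link_edges \<B> y))"

definition atomic :: "'a set \<Rightarrow> 'a set set \<Rightarrow> 'a set set \<Rightarrow> bool" where
  "atomic X \<G> \<B> \<longleftrightarrow> (\<forall>G\<in>\<G>. pan_Hamiltonian X \<B> G)"


section \<open>The game\<close>

datatype player = Xeno | Ophelia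

fun opponent :: "player \<Rightarrow> player" where
  "opponent Xeno = Ophelia"
| "opponent Ophelia = Xeno"

text \<open>
  A state of the game is recorded as its history, the list of all points chosen so far in
  chronological order. Xeno made the choices at the even positions (counted from 0).
\<close>

definition to_move :: "'a list \<Rightarrow> player" where
  "to_move h = (if even (length h) then Xeno else Ophelia)"

definition chosen :: "player \<Rightarrow> 'a list \<Rightarrow> 'a set" where
  "chosen p h = {h ! i | i. i < length h \<and> to_move (take i h) = p}"

definition completed :: "'a set set \<Rightarrow> player \<Rightarrow> 'a list \<Rightarrow> bool" where
  "completed \<B> p h \<longleftrightarrow> (\<exists>b\<in>\<B>. b \<subseteq> chosen p h)"

definition game_over :: "'a set \<Rightarrow> 'a set set \<Rightarrow> 'a list \<Rightarrow> bool" where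
  "game_over X \<B> h \<longleftrightarrow> set h = X \<or> completed \<B> Xeno h \<or> completed \<B> Ophelia h"

text \<open>
  Completing a block is monotone in the history, so in an ongoing game no earlier state
  was terminal.
\<close>

definition ongoing :: "'a set \<Rightarrow> 'a set set \<Rightarrow> 'a list \<Rightarrow> bool" where
  "ongoing X \<B> h \<longleftrightarrow> distinct h \<and> set h \<subseteq> X \<and> \<not> game_over X \<B> h"

type_synonym 'a strategy = "'a list \<Rightarrow> 'a"

text \<open>
  The history after \<open>k\<close> moves when Xeno follows \<open>\<sigma>\<close> and Ophelia follows \<open>\<tau>\<close>; it stays
  constant once the game is over.
\<close>

fun play :: "'a set \<Rightarrow> 'a set set \<Rightarrow> 'a strategy \<Rightarrow> 'a strategy \<Rightarrow> nat \<Rightarrow> 'a list" where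
  "play X \<B> \<sigma> \<tau> 0 = []"
| "play X \<B> \<sigma> \<tau> (Suc k) =
     (let h = play X \<B> \<sigma> \<tau> k in
      if game_over X \<B> h then h
      else h @ [case to_move h of Xeno \<Rightarrow> \<sigma> h | Ophelia \<Rightarrow> \<tau> h])"

text \<open>As play stops with the first completed block, at most one player can win.\<close>

definition wins ::
    "'a set \<Rightarrow> 'a set set \<Rightarrow> player \<Rightarrow> 'a strategy \<Rightarrow> 'a strategy \<Rightarrow> bool" where
  "wins X \<B> p \<sigma> \<tau> \<longleftrightarrow> (\<exists>k. completed \<B> p (play X \<B> \<sigma> \<tau> k))"


section \<open>Score-optimizing strategies\<close>

text \<open>The weights are always computed from Xeno's point of view, whoever is to move.\<close>

definition block_weight :: "'a list \<Rightarrow> 'a set \<Rightarrow> real" where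
  "block_weight h b =
     (if b \<inter> chosen Ophelia h = {}
      then 2 powi (int (card (chosen Xeno h \<inter> b)) - int (card b)) else 0)"

definition point_weight :: "'a set set \<Rightarrow> 'a list \<Rightarrow> 'a \<Rightarrow> real" where
  "point_weight \<B> h u = (\<Sum>b\<in>{b \<in> \<B>. u \<in> b}. block_weight h b)"

definition completing_point :: "'a set \<Rightarrow> 'a set set \<Rightarrow> player \<Rightarrow> 'a list \<Rightarrow> 'a \<Rightarrow> bool" where
  "completing_point X \<B> p h u \<longleftrightarrow>
     u \<in> X - set h \<and> (\<exists>b\<in>\<B>. u \<in> b \<and> b \<subseteq> insert u (chosen p h))"

text \<open>
  A player blocks an immediate win of the opponent by taking a point with which the
  opponent would complete a block; if there are several such points, any of them may be taken.
\<close>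

definition score_optimizing_move ::
    "'a set \<Rightarrow> 'a set set \<Rightarrow> player \<Rightarrow> 'a list \<Rightarrow> 'a \<Rightarrow> bool" where
  "score_optimizing_move X \<B> p h u \<longleftrightarrow>
     u \<in> X - set h \<and>
     (if \<exists>v. completing_point X \<B> p h v
      then completing_point X \<B> p h u
      else if \<exists>v. completing_point X \<B> (opponent p) h v
      then completing_point X \<B> (opponent p) h u
      else \<forall>v\<in>X - set h. point_weight \<B> h v \<le> point_weight \<B> h u)"

text \<open>Ties may be broken in any way, in particular depending on the whole history.\<close>

definition score_optimizing ::
    "'a set \<Rightarrow> 'a set set \<Rightarrow> player \<Rightarrow> 'a strategy \<Rightarrow> bool" where
  "score_optimizing X \<B> p s \<longleftrightarrow>
     (\<forall>h. ongoing X \<B> h \<and> to_move h = p \<longrightarrow> score_optimizing_move X \<B> p h (s h))"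

end

theory Submission
  imports Defs
begin

text \<open>
  Score-optimizing play is forced. If Xeno opens with \<open>x\<close> in a group \<open>H\<close>, the weights make
  Ophelia take a point \<open>a\<close> of another group \<open>G\<close>, and then make Xeno take a second point \<open>b\<close>
  of \<open>G\<close>. From now on Xeno threatens to complete a block through \<open>b\<close>, Ophelia's block is her
  own threat through \<open>a\<close>, and so on: the players walk along the cycle $G[a] \cup G[b]$, Xeno
  taking its points in \<open>H\<close> and Ophelia those in the third group \<open>K\<close>. As the cycle is
  Hamiltonian, Ophelia ends up with all of \<open>K\<close>, which meets every block. Hence any
  score-optimizing strategy of Ophelia works, whatever its tie-breaking rule.
\<close>

section \<open>Closed vertex sets in a cycle\<close>

text \<open>The form in which Hamiltonicity is applied: walking along the cycle edge by edge from
  any vertex of \<open>U\<close> never leaves \<open>U\<close> and reaches every vertex.\<close>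

lemma single_cycle_closed:
  assumes "single_cycle V E" "U \<subseteq> V" "U \<noteq> {}"
    and closed: "\<And>u v. u \<in> U \<Longrightarrow> {u, v} \<in> E \<Longrightarrow> v \<in> U"
  shows "U = V"
proof -
  obtain c where c: "3 \<le> length c" "set c = V"
      "E = {{c ! i, c ! (Suc i mod length c)} | i. i < length c}"
    using assms(1) unfolding single_cycle_def by blast
  define m where "m = length c"
  have m: "m > 0" using c(1) m_def by linarith
  have step: "c ! (Suc i mod m) \<in> U" if "i < m" "c ! i \<in> U" for i
    using closed[OF that(2)] c(3) that(1) unfolding m_def by blast
  obtain i0 where i0: "i0 < m" "c ! i0 \<in> U"
    using assms(2,3) c(2) unfolding m_def by (metis ex_in_conv in_set_conv_nth subsetD)
  have iter: "c ! ((i0 + j) mod m) \<in> U" for j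
  proof (induction j)
    case 0
    then show ?case using i0 by simp
  next
    case (Suc j)
    then show ?case using step[of "(i0 + j) mod m"] m by (simp add: mod_Suc_eq)
  qed
  have "v \<in> U" if v: "v \<in> V" for v
  proof -
    obtain i where i: "i < m" "v = c ! i"
      using v c(2) unfolding m_def by (auto simp: in_set_conv_nth)
    \<comment> \<open>After \<open>m - i0\<close> steps the walk is at index 0, and \<open>i\<close>
      further steps lead to index \<open>i\<close>; the subtraction is exact because
      \<open>i0 < m\<close>.\<close>
    have "(i0 + (m - i0 + i)) mod m = i" using i0 i by simp
    then show ?thesis using iter[of "m - i0 + i"] i by simp
  qed
  then show ?thesis using assms(2) by blast
qed


section \<open>Histories\<close>

lemma to_move_append [simp]: "to_move (h @ [x]) = opponent (to_move h)"
  by (simp add: to_move_def)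

lemma chosen_Nil [simp]: "chosen p [] = {}"
  by (simp add: chosen_def)

lemma chosen_image: "chosen p h = (!) h ` {i. i < length h \<and> to_move (take i h) = p}"
  unfolding chosen_def by (rule setcompr_eq_image)

lemma chosen_append:
  "chosen p (h @ [x]) = (if to_move h = p then insert x (chosen p h) else chosen p h)"
proof -
  let ?I = "{i. i < length h \<and> to_move (take i h) = p}"
  have "{i. i < length (h @ [x]) \<and> to_move (take i (h @ [x])) = p} =
      ?I \<union> (if to_move h = p then {length h} else {})"
    by (auto simp: less_Suc_eq)
  moreover have "(!) (h @ [x]) ` ?I = (!) h ` ?I"
    by (rule image_cong) (auto simp: nth_append)
  ultimately show ?thesis
    unfolding chosen_image by (simp add: image_Un)
qed

lemma set_eq_chosen: "set h = chosen Xeno h \<union> chosen Ophelia h"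
proof (induction h rule: rev_induct)
  case (snoc x h)
  then show ?case by (cases "to_move h") (auto simp: chosen_append)
qed simp

lemma chosen_disjoint: "distinct h \<Longrightarrow> chosen Xeno h \<inter> chosen Ophelia h = {}"
proof (induction h rule: rev_induct)
  case (snoc x h)
  then show ?case using set_eq_chosen[of h] by (cases "to_move h") (auto simp: chosen_append)
qed simp

lemma chosen_play_mono:
  assumes "i \<le> j"
  shows "chosen p (play X \<B> \<sigma> \<tau> i) \<subseteq> chosen p (play X \<B> \<sigma> \<tau> j)"
  using assms by (induction j rule: dec_induct) (auto simp: Let_def chosen_append)

section \<open>Existence and legality of score-optimizing play\<close>

text \<open>Every branch of the rule can be met: completing points are free by definition, and in an
  ongoing game the free points form a finite nonempty set, on which the weight attains its
  maximum.\<close>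

lemma score_optimizing_move_exists:
  assumes "finite X" "ongoing X \<B> h"
  shows "\<exists>u. score_optimizing_move X \<B> p h u"
proof -
  have free: "finite (X - set h)" "X - set h \<noteq> {}"
    using assms unfolding ongoing_def game_over_def by auto
  have "\<exists>u\<in>X - set h. \<forall>v\<in>X - set h. point_weight \<B> h v \<le> point_weight \<B> h u"
  proof -
    let ?W = "point_weight \<B> h ` (X - set h)"
    have W: "finite ?W" "?W \<noteq> {}" using free by auto
    obtain u where "u \<in> X - set h" "point_weight \<B> h u = Max ?W"
      using Max_in[OF W] by (metis imageE)
    then show ?thesis using Max_ge[OF W(1)] by (metis imageI)
  qed
  moreover have "v \<in> X - set h" if "completing_point X \<B> p' h v" for p' v
    using that unfolding completing_point_def by blast
  ultimately show ?thesis
    unfolding score_optimizing_move_def by metis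
qed

text \<open>Supplies the witness of the theorem. At histories that are not ongoing,
  \<open>SOME\<close> may return anything, as \<open>score_optimizing\<close> imposes no condition
  there.\<close>

lemma score_optimizing_exists:
  assumes "finite X"
  shows "\<exists>\<tau>. score_optimizing X \<B> p \<tau>"
proof -
  have "score_optimizing X \<B> p (\<lambda>h. SOME u. score_optimizing_move X \<B> p h u)"
    unfolding score_optimizing_def
    using score_optimizing_move_exists[OF assms] by (metis someI_ex)
  then show ?thesis by blast
qed

text \<open>Strategies are total functions with unrestricted values. Along \<open>play\<close> they
  are consulted only at ongoing histories, which is exactly where the scoring rule makes them pick a
  free point.\<close>

lemma play_legal:
  assumes "score_optimizing X \<B> Xeno \<sigma>" "score_optimizing X \<B> Ophelia \<tau>"
  shows "distinct (play X \<B> \<sigma> \<tau> k) \<and> set (play X \<B> \<sigma> \<tau> k) \<subseteq> X"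
proof (induction k)
  case (Suc k)
  define h where "h = play X \<B> \<sigma> \<tau> k"
  show ?case
  proof (cases "game_over X \<B> h")
    case True
    then show ?thesis using Suc by (simp add: h_def)
  next
    case False
    then have og: "ongoing X \<B> h" using Suc by (simp add: ongoing_def h_def)
    have "(case to_move h of Xeno \<Rightarrow> \<sigma> h | Ophelia \<Rightarrow> \<tau> h) \<in> X - set h"
      using assms og unfolding score_optimizing_def score_optimizing_move_def
      by (cases "to_move h") auto
    then show ?thesis using Suc False by (simp add: Let_def flip: h_def)
  qed
qed simp

lemma play_SucI:
  assumes "play X \<B> \<sigma> \<tau> k = h" "\<not> game_over X \<B> h"
    and "(case to_move h of Xeno \<Rightarrow> \<sigma> h | Ophelia \<Rightarrow> \<tau> h) = u"
  shows "play X \<B> \<sigma> \<tau> (Suc k) = h @ [u]"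
  using assms by (simp add: Let_def)


section \<open>Counting blocks\<close>

locale design3 =
  fixes n :: nat and X :: "'a set" and \<G> \<B> :: "'a set set"
  assumes td: "transversal_design3 n X \<G> \<B>" and n_pos: "n > 0"
begin

lemma finite_X: "finite X" and partition: "partition_on X \<G>" and card_groups: "card \<G> = 3"
  and card_group: "A \<in> \<G> \<Longrightarrow> card A = n"
  and block_sub: "b \<in> \<B> \<Longrightarrow> b \<subseteq> X" and card_block: "b \<in> \<B> \<Longrightarrow> card b = 3"
  using td unfolding transversal_design3_def by auto

lemma block_group_unique:
  "b \<in> \<B> \<Longrightarrow> A \<in> \<G> \<Longrightarrow> x \<in> b \<Longrightarrow> x \<in> A \<Longrightarrow> y \<in> b \<Longrightarrow> y \<in> A \<Longrightarrow> x = y"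
  using td unfolding transversal_design3_def by (metis IntI)

lemma group_sub: "A \<in> \<G> \<Longrightarrow> A \<subseteq> X"
  using partition unfolding partition_on_def by auto

lemma group_disjoint: "A \<in> \<G> \<Longrightarrow> A' \<in> \<G> \<Longrightarrow> A \<noteq> A' \<Longrightarrow> A \<inter> A' = {}"
  using partition unfolding partition_on_def disjoint_def by blast

lemma pair_block:
  assumes "A \<in> \<G>" "A' \<in> \<G>" "A \<noteq> A'" "x \<in> A" "y \<in> A'"
  shows "\<exists>!b. b \<in> \<B> \<and> x \<in> b \<and> y \<in> b"
proof -
  have separated: "\<forall>C\<in>\<G>. \<not> (x \<in> C \<and> y \<in> C)"
    using assms group_disjoint by (metis disjoint_iff)
  have points: "x \<in> X" "y \<in> X" using assms group_sub by blast+
  have "\<forall>x\<in>X. \<forall>y\<in>X. (\<forall>G\<in>\<G>. \<not> (x \<in> G \<and> y \<in> G)) \<longrightarrow>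
      (\<exists>!b. b \<in> \<B> \<and> x \<in> b \<and> y \<in> b)"
    using td unfolding transversal_design3_def by (elim conjE)
  from this[THEN bspec, OF points(1), THEN bspec, OF points(2), THEN mp, OF separated]
  show ?thesis .
qed

lemma finite_blocks: "finite \<B>"
  using finite_X block_sub by (metis PowI finite_Pow_iff finite_subset subsetI)

lemma finite_block: "b \<in> \<B> \<Longrightarrow> finite b"
  using block_sub finite_X finite_subset by metis

text \<open>Pigeonhole: sending each of the three points of a block to its group is injective, and
  there are only three groups, so every group is hit.\<close>

lemma block_meets:
  assumes "b \<in> \<B>" "A \<in> \<G>"
  obtains x where "x \<in> b" "x \<in> A"
proof -
  define gr where "gr x = (SOME C. C \<in> \<G> \<and> x \<in> C)" for x
  have gr: "gr x \<in> \<G> \<and> x \<in> gr x" if "x \<in> b" for x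
  proof -
    have "x \<in> \<Union>\<G>" using that assms(1) block_sub partition unfolding partition_on_def by blast
    then have "\<exists>C. C \<in> \<G> \<and> x \<in> C" by blast
    then show ?thesis unfolding gr_def by (rule someI_ex)
  qed
  have inj: "inj_on gr b"
    using gr block_group_unique[OF assms(1)] unfolding inj_on_def by metis
  have fin: "finite \<G>" using card_groups by (metis card.infinite zero_neq_numeral)
  have "gr ` b = \<G>"
    using card_subset_eq[OF fin, of "gr ` b"] gr card_image[OF inj] card_groups
      card_block[OF assms(1)] by auto
  then obtain x where "x \<in> b" "gr x = A" using assms(2) by auto
  then show thesis using gr that by blast
qed

lemma card_blocks_two:
  assumes "A \<in> \<G>" "A' \<in> \<G>" "A \<noteq> A'" "x \<in> A" "y \<in> A'"
  shows "card {b \<in> \<B>. x \<in> b \<and> y \<in> b} = 1"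
proof -
  obtain b where "b \<in> \<B> \<and> x \<in> b \<and> y \<in> b" "\<And>b'. b' \<in> \<B> \<and> x \<in> b' \<and> y \<in> b' \<Longrightarrow> b' = b"
    using pair_block[OF assms] by metis
  then have "{b \<in> \<B>. x \<in> b \<and> y \<in> b} = {b}" by blast
  then show ?thesis by simp
qed

lemma card_blocks_same_group:
  assumes "A \<in> \<G>" "x \<in> A" "y \<in> A" "x \<noteq> y"
  shows "card {b \<in> \<B>. x \<in> b \<and> y \<in> b} = 0"
proof -
  have "{b \<in> \<B>. x \<in> b \<and> y \<in> b} = {}" using assms block_group_unique by blast
  then show ?thesis by (metis card.empty)
qed

text \<open>For any other group \<open>A'\<close>, the blocks through \<open>x\<close> correspond to
  the points of \<open>A'\<close>: each such point determines one block with \<open>x\<close>, and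
  each block through \<open>x\<close> has one point in \<open>A'\<close>.\<close>

lemma card_blocks_point:
  assumes "A \<in> \<G>" "x \<in> A"
  shows "card {b \<in> \<B>. x \<in> b} = n"
proof -
  have "\<not> \<G> \<subseteq> {A}" using card_groups card_mono[of "{A}" \<G>] by auto
  then obtain A' where A': "A' \<in> \<G>" "A \<noteq> A'" by blast
  define pt where "pt y = (THE b. b \<in> \<B> \<and> x \<in> b \<and> y \<in> b)" for y
  have pt: "pt y \<in> \<B> \<and> x \<in> pt y \<and> y \<in> pt y" if "y \<in> A'" for y
    unfolding pt_def using theI'[OF pair_block[OF assms(1) A' assms(2) that]] .
  have "bij_betw pt A' {b \<in> \<B>. x \<in> b}"
  proof (rule bij_betw_imageI)
    show "inj_on pt A'"
      by (rule inj_onI) (metis pt block_group_unique A'(1))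
    show "pt ` A' = {b \<in> \<B>. x \<in> b}"
    proof (intro equalityI subsetI)
      fix b assume b: "b \<in> {b \<in> \<B>. x \<in> b}"
      then obtain y where y: "y \<in> b" "y \<in> A'" using block_meets[of b A'] A' by blast
      then have "pt y = b" using b pt pair_block[OF assms(1) A' assms(2) y(2)] by blast
      then show "b \<in> pt ` A'" using y by blast
    qed (use pt in auto)
  qed
  then show ?thesis using bij_betw_same_card card_group A' by metis
qed

section \<open>Weights and threats in the opening\<close>

text \<open>In the opening, block weights are expressed or bounded by a constant plus indicators of
  the points already taken. This turns a point weight into a count of blocks through one or two
  points.\<close>

lemma sum_blocks_indicator:
  "(\<Sum>b\<in>{b \<in> \<B>. u \<in> b}. c + (if y \<in> b then d else 0) + (if z \<in> b then e else 0)) =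
     real (card {b \<in> \<B>. u \<in> b}) * c + real (card {b \<in> \<B>. u \<in> b \<and> y \<in> b}) * d
       + real (card {b \<in> \<B>. u \<in> b \<and> z \<in> b}) * e"
proof -
  have "(\<Sum>b\<in>{b \<in> \<B>. u \<in> b}. if w \<in> b then k else 0) =
      real (card {b \<in> \<B>. u \<in> b \<and> w \<in> b}) * k" for w and k :: real
  proof -
    have "(\<Sum>b\<in>{b \<in> \<B>. u \<in> b}. if w \<in> b then k else 0) =
        (\<Sum>b\<in>{b \<in> {b \<in> \<B>. u \<in> b}. w \<in> b}. k)"
      by (rule sum.inter_filter[symmetric]) (simp add: finite_blocks)
    also have "{b \<in> {b \<in> \<B>. u \<in> b}. w \<in> b} = {b \<in> \<B>. u \<in> b \<and> w \<in> b}" by auto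
    finally show ?thesis by simp
  qed
  then show ?thesis by (simp add: sum.distrib)
qed

text \<open>The two nonzero values are 2^(1-3) and 2^(0-3).\<close>

lemma block_weight_one_chosen:
  assumes "b \<in> \<B>" "chosen Xeno h = {x}"
  shows "block_weight h b = (if b \<inter> chosen Ophelia h = {} then if x \<in> b then 1/4 else 1/8 else 0)"
  using assms card_block[OF assms(1)]
  by (auto simp: block_weight_def power_int_def power2_eq_square power3_eq_cube)

text \<open>While each player has at most one point there are no threats, so Ophelia's first move
  and Xeno's second are decided by weight alone.\<close>

lemma completing_needs_two:
  assumes "completing_point X \<B> p h u"
  shows "card (chosen p h) \<ge> 2"
proof -
  obtain b where b: "b \<in> \<B>" "b \<subseteq> insert u (chosen p h)"
    using assms unfolding completing_point_def by blast
  have fin: "finite (chosen p h)"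
    unfolding chosen_image by simp
  have "card b \<le> card (insert u (chosen p h))" using b(2) fin by (intro card_mono) auto
  also have "\<dots> \<le> Suc (card (chosen p h))" by (simp add: card_insert_if fin)
  finally show ?thesis using card_block[OF b(1)] by simp
qed

lemma not_completed_few:
  assumes "card (chosen p h) \<le> 2"
  shows "\<not> completed \<B> p h"
proof
  assume "completed \<B> p h"
  then obtain b where b: "b \<in> \<B>" "b \<subseteq> chosen p h" unfolding completed_def by blast
  have "card b \<le> card (chosen p h)" using b(2) by (intro card_mono) (auto simp: chosen_image)
  then show False using card_block[OF b(1)] assms by simp
qed

text \<open>A point outside \<open>H\<close> lies on \<open>n\<close> blocks, one of them through
  \<open>x\<close>, which gives weight (n+1)/8. A further point of \<open>H\<close> shares no block
  with \<open>x\<close> and weighs only n/8.\<close>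

lemma first_reply_other_group:
  assumes "score_optimizing X \<B> Ophelia \<tau>" "H \<in> \<G>" "x \<in> H"
  shows "\<tau> [x] \<in> X - H" "ongoing X \<B> [x]"
proof -
  have ch: "chosen Xeno [x] = {x}" "chosen Ophelia [x] = {}"
    using chosen_append[of _ "[]" x] by (auto simp: to_move_def)
  have "\<not> \<G> \<subseteq> {H}" using card_groups card_mono[of "{H}" \<G>] by auto
  then obtain G where G: "G \<in> \<G>" "H \<noteq> G" by blast
  obtain v where v: "v \<in> G" using card_group[OF G(1)] n_pos by fastforce
  have v': "v \<in> X - set [x]"
    using v G group_sub group_disjoint[OF assms(2) G(1,2)] assms(3) by auto
  have w: "point_weight \<B> [x] u =
      (real (card {b \<in> \<B>. u \<in> b}) + real (card {b \<in> \<B>. u \<in> b \<and> x \<in> b})) / 8" for u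
  proof -
    have "point_weight \<B> [x] u =
        (\<Sum>b\<in>{b \<in> \<B>. u \<in> b}. 1/8 + (if x \<in> b then 1/8 else 0) + (if x \<in> b then 0 else 0))"
      unfolding point_weight_def
      by (rule sum.cong) (auto simp: block_weight_one_chosen[OF _ ch(1)] ch(2))
    then show ?thesis unfolding sum_blocks_indicator by simp
  qed
  have not_over: "\<not> game_over X \<B> [x]"
    using v' not_completed_few[of _ "[x]"] ch unfolding game_over_def by auto
  then show og: "ongoing X \<B> [x]"
    using assms group_sub unfolding ongoing_def by auto
  have no: "\<not> completing_point X \<B> p [x] u" for p u
    using completing_needs_two[of p "[x]" u] ch by (cases p) auto
  have move: "score_optimizing_move X \<B> Ophelia [x] (\<tau> [x])"
    using assms(1) og unfolding score_optimizing_def by (simp add: to_move_def)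
  then have in_X: "\<tau> [x] \<in> X - set [x]" and
    max: "point_weight \<B> [x] v \<le> point_weight \<B> [x] (\<tau> [x])"
    using no v' unfolding score_optimizing_move_def by auto
  have "\<tau> [x] \<notin> H"
  proof
    assume u: "\<tau> [x] \<in> H"
    have "point_weight \<B> [x] (\<tau> [x]) = n / 8"
      using in_X card_blocks_point[OF assms(2) u] card_blocks_same_group[OF assms(2) u assms(3)]
      by (simp add: w)
    moreover have "point_weight \<B> [x] v = (n + 1) / 8"
      using card_blocks_point[OF G(1) v] card_blocks_two[OF G(1) assms(2) _ v assms(3)] G(2)
      by (simp add: w)
    ultimately show False using max by simp
  qed
  then show "\<tau> [x] \<in> X - H" using in_X by blast
qed

end


section \<open>The forced sequence of moves\<close>

text \<open>The roles of the groups are fixed by the opening: \<open>H\<close> contains Xeno's first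
  point and his later forced ones, \<open>G\<close> contains Ophelia's first point and Xeno's
  second, and \<open>K\<close> is the group that Ophelia exhausts.\<close>

locale groups3 = design3 +
  fixes G H K :: "'a set"
  assumes groups: "\<G> = {G, H, K}" and groups_distinct: "G \<noteq> H" "G \<noteq> K" "H \<noteq> K"
begin

lemma G_in: "G \<in> \<G>" and H_in: "H \<in> \<G>" and K_in: "K \<in> \<G>"
  using groups by auto

lemma groups_disjoint: "G \<inter> H = {}" "G \<inter> K = {}" "H \<inter> K = {}"
  using group_disjoint G_in H_in K_in groups_distinct by blast+

lemma X_eq: "X = G \<union> H \<union> K"
  using partition groups unfolding partition_on_def by auto

lemma block_cases:
  assumes "b \<in> \<B>"
  obtains x y z where "x \<in> G" "y \<in> H" "z \<in> K" "b = {x, y, z}"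
proof -
  obtain x y z where xyz: "x \<in> b" "x \<in> G" "y \<in> b" "y \<in> H" "z \<in> b" "z \<in> K"
    using block_meets[OF assms] G_in H_in K_in by metis
  then have "card {x, y, z} = 3" using groups_disjoint by (auto simp: card_insert_if)
  then have "{x, y, z} = b"
    using card_subset_eq[OF finite_block[OF assms], of "{x, y, z}"] card_block[OF assms] xyz by auto
  then show thesis using that xyz by blast
qed

section \<open>Link graphs as matchings between two groups\<close>

text \<open>For \<open>x\<close> in \<open>G\<close> the link graph of \<open>x\<close> is a perfect
  matching between \<open>H\<close> and \<open>K\<close>; \<open>mateK x\<close> and
  \<open>mateH x\<close> are its two directions, mutually inverse bijections.\<close>

definition mateK :: "'a \<Rightarrow> 'a \<Rightarrow> 'a" where
  "mateK x y = (THE z. z \<in> K \<and> {x, y, z} \<in> \<B>)"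

definition mateH :: "'a \<Rightarrow> 'a \<Rightarrow> 'a" where
  "mateH x z = (THE y. y \<in> H \<and> {x, y, z} \<in> \<B>)"

lemma mateK:
  assumes "x \<in> G" "y \<in> H"
  shows "mateK x y \<in> K" "{x, y, mateK x y} \<in> \<B>"
    and "z \<in> K \<Longrightarrow> {x, y, z} \<in> \<B> \<Longrightarrow> mateK x y = z"
proof -
  obtain b where b: "b \<in> \<B>" "x \<in> b" "y \<in> b"
    and uniq: "\<And>b'. b' \<in> \<B> \<Longrightarrow> x \<in> b' \<Longrightarrow> y \<in> b' \<Longrightarrow> b' = b"
    using pair_block[OF G_in H_in groups_distinct(1) assms] by metis
  obtain z where z: "z \<in> K" "b = {x, y, z}"
    using block_cases[OF b(1)] b assms groups_disjoint
    by (metis disjoint_iff insertE singletonD)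
  have eq: "z' = z" if "z' \<in> K" "{x, y, z'} \<in> \<B>" for z'
    using uniq[OF that(2)] block_group_unique[OF b(1) K_in] that(1) z by blast
  have "\<exists>!z. z \<in> K \<and> {x, y, z} \<in> \<B>" using z b eq by metis
  from theI'[OF this] show *: "mateK x y \<in> K" "{x, y, mateK x y} \<in> \<B>"
    unfolding mateK_def by auto
  show "z \<in> K \<Longrightarrow> {x, y, z} \<in> \<B> \<Longrightarrow> mateK x y = z" for z using eq * by metis
qed

lemma mateH:
  assumes "x \<in> G" "z \<in> K"
  shows "mateH x z \<in> H" "{x, mateH x z, z} \<in> \<B>"
    and "y \<in> H \<Longrightarrow> {x, y, z} \<in> \<B> \<Longrightarrow> mateH x z = y"
proof -
  obtain b where b: "b \<in> \<B>" "x \<in> b" "z \<in> b"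
    and uniq: "\<And>b'. b' \<in> \<B> \<Longrightarrow> x \<in> b' \<Longrightarrow> z \<in> b' \<Longrightarrow> b' = b"
    using pair_block[OF G_in K_in groups_distinct(2) assms] by metis
  obtain y where y: "y \<in> H" "b = {x, y, z}"
    using block_cases[OF b(1)] b assms groups_disjoint
    by (metis disjoint_iff insertE singletonD)
  have eq: "y' = y" if "y' \<in> H" "{x, y', z} \<in> \<B>" for y'
    using uniq[OF that(2)] block_group_unique[OF b(1) H_in] that(1) y by blast
  have "\<exists>!y. y \<in> H \<and> {x, y, z} \<in> \<B>" using y b eq by metis
  from theI'[OF this] show *: "mateH x z \<in> H" "{x, mateH x z, z} \<in> \<B>"
    unfolding mateH_def by auto
  show "y \<in> H \<Longrightarrow> {x, y, z} \<in> \<B> \<Longrightarrow> mateH x z = y" for y using eq * by metis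
qed

lemma mateH_mateK: "x \<in> G \<Longrightarrow> y \<in> H \<Longrightarrow> mateH x (mateK x y) = y"
  using mateK(1,2) mateH(3) by blast

lemma mateK_mateH: "x \<in> G \<Longrightarrow> z \<in> K \<Longrightarrow> mateK x (mateH x z) = z"
  using mateH(1,2) mateK(3) by blast

text \<open>A block has one point in each group. Ophelia has none in \<open>H\<close>, so the
  missing point is the one in \<open>H\<close>; then the point in \<open>G\<close> must be
  \<open>a\<close> and the one in \<open>K\<close> must come from \<open>S\<close>.\<close>

lemma completing_Ophelia:
  assumes "chosen Ophelia h = insert a S" "a \<in> G" "S \<subseteq> K"
  shows "completing_point X \<B> Ophelia h u \<longleftrightarrow> u \<notin> set h \<and> u \<in> mateH a ` S"
proof
  assume l: "completing_point X \<B> Ophelia h u"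
  then obtain b where b: "b \<in> \<B>" "b \<subseteq> insert u (insert a S)" and free: "u \<notin> set h"
    unfolding completing_point_def assms(1) by auto
  obtain x y z where c: "x \<in> G" "y \<in> H" "z \<in> K" "b = {x, y, z}" using block_cases[OF b(1)] .
  have "y \<noteq> a" "y \<notin> S" "x \<notin> S" "x \<noteq> y" "z \<noteq> y" "z \<noteq> a"
    using c assms(2,3) groups_disjoint by auto
  then have "y = u" "x = a" "z \<in> S" using b(2) c(4) by auto
  then show "u \<notin> set h \<and> u \<in> mateH a ` S"
    using mateH(3)[of a z u] b(1) c assms(2) free by auto
next
  assume r: "u \<notin> set h \<and> u \<in> mateH a ` S"
  then obtain z where z: "z \<in> S" "u = mateH a z" by blast
  have zK: "z \<in> K" using z assms by blast
  show "completing_point X \<B> Ophelia h u"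
    unfolding completing_point_def assms(1)
    using mateH(1,2)[OF assms(2) zK] X_eq z r by (intro conjI bexI[of _ "{a, u, z}"]) auto
qed

text \<open>The mirror image, with \<open>H\<close> and \<open>K\<close> exchanged: Xeno's missing
  point is always in \<open>K\<close>.\<close>

lemma completing_Xeno:
  assumes "chosen Xeno h = insert a S" "a \<in> G" "S \<subseteq> H"
  shows "completing_point X \<B> Xeno h u \<longleftrightarrow> u \<notin> set h \<and> u \<in> mateK a ` S"
proof
  assume l: "completing_point X \<B> Xeno h u"
  then obtain b where b: "b \<in> \<B>" "b \<subseteq> insert u (insert a S)" and free: "u \<notin> set h"
    unfolding completing_point_def assms(1) by auto
  obtain x y z where c: "x \<in> G" "y \<in> H" "z \<in> K" "b = {x, y, z}" using block_cases[OF b(1)] .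
  have "z \<noteq> a" "z \<notin> S" "x \<notin> S" "x \<noteq> z" "y \<noteq> z" "y \<noteq> a"
    using c assms(2,3) groups_disjoint by auto
  then have "z = u" "x = a" "y \<in> S" using b(2) c(4) by auto
  then show "u \<notin> set h \<and> u \<in> mateK a ` S"
    using mateK(3)[of a y u] b(1) c assms(2) free by auto
next
  assume r: "u \<notin> set h \<and> u \<in> mateK a ` S"
  then obtain y where y: "y \<in> S" "u = mateK a y" by blast
  have yH: "y \<in> H" using y assms by blast
  show "completing_point X \<B> Xeno h u"
    unfolding completing_point_def assms(1)
    using mateK(1,2)[OF assms(2) yH] X_eq y r by (intro conjI bexI[of _ "{a, y, u}"]) auto
qed

text \<open>A point of \<open>G\<close> other than \<open>a\<close> loses no block to Ophelia and
  shares one block with \<open>x\<close>: weight (n+1)/8. Points of \<open>H\<close> gain nothing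
  from \<open>x\<close>, and for points of \<open>K\<close> the gain from \<open>x\<close> is offset
  by the block through \<open>a\<close>, so both weigh at most n/8.\<close>

lemma second_move_same_group:
  assumes "score_optimizing X \<B> Xeno \<sigma>" "x \<in> H" "a \<in> G" "n \<ge> 2"
  shows "\<sigma> [x, a] \<in> G - {a}" "ongoing X \<B> [x, a]"
proof -
  have xa: "x \<noteq> a" using assms groups_disjoint by blast
  have ch: "chosen Xeno [x, a] = {x}" "chosen Ophelia [x, a] = {a}"
    using chosen_append[of _ "[x]" a] chosen_append[of _ "[]" x] by (auto simp: to_move_def)
  have "\<not> G \<subseteq> {a}" using card_group[OF G_in] assms(4) card_mono[of "{a}" G] by auto
  then obtain v where v: "v \<in> G" "v \<noteq> a" by blast
  have v': "v \<in> X - set [x, a]" using v assms groups_disjoint X_eq by auto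
  have not_over: "\<not> game_over X \<B> [x, a]"
    using v' not_completed_few[of _ "[x, a]"] ch unfolding game_over_def by auto
  then show og: "ongoing X \<B> [x, a]"
    using assms xa X_eq unfolding ongoing_def by auto
  have no: "\<not> completing_point X \<B> p [x, a] u" for p u
    using completing_needs_two[of p "[x, a]" u] ch by (cases p) auto
  have move: "score_optimizing_move X \<B> Xeno [x, a] (\<sigma> [x, a])"
    using assms(1) og unfolding score_optimizing_def by (simp add: to_move_def)
  define u where "u = \<sigma> [x, a]"
  have u: "u \<in> X - {x, a}" and
    max: "point_weight \<B> [x, a] v \<le> point_weight \<B> [x, a] u"
    using no v' move unfolding score_optimizing_move_def u_def by auto
  have bw: "block_weight [x, a] b = (if a \<notin> b then if x \<in> b then 1/4 else 1/8 else 0)"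
    if "b \<in> \<B>" for b
    using block_weight_one_chosen[OF that ch(1)] ch(2) by simp
  let ?d = "\<lambda>u y. real (card {b \<in> \<B>. u \<in> b \<and> y \<in> b})"
  \<comment> \<open>Only a bound: a block through both \<open>x\<close> and \<open>a\<close> has
    weight 0, but the sum of indicators counts 1/8 for it.\<close>
  have upper: "point_weight \<B> [x, a] w \<le>
      real (card {b \<in> \<B>. w \<in> b}) / 8 + ?d w x / 8 - ?d w a / 8" for w
  proof -
    have "point_weight \<B> [x, a] w \<le>
        (\<Sum>b\<in>{b \<in> \<B>. w \<in> b}. 1/8 + (if x \<in> b then 1/8 else 0) + (if a \<in> b then -1/8 else 0))"
      unfolding point_weight_def by (rule sum_mono) (auto simp: bw)
    then show ?thesis unfolding sum_blocks_indicator by simp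
  qed
  have "point_weight \<B> [x, a] v = (real n + 1) / 8"
  proof -
    have "point_weight \<B> [x, a] v =
        (\<Sum>b\<in>{b \<in> \<B>. v \<in> b}. 1/8 + (if x \<in> b then 1/8 else 0) + (if a \<in> b then 0 else 0))"
      unfolding point_weight_def
      using block_group_unique[OF _ G_in] v assms(3) by (intro sum.cong) (auto simp: bw)
    then show ?thesis
      unfolding sum_blocks_indicator
      using card_blocks_point[OF G_in v(1)]
        card_blocks_two[OF G_in H_in groups_distinct(1) v(1) assms(2)]
      by simp
  qed
  then have large: "(real n + 1) / 8 \<le> point_weight \<B> [x, a] u" using max by simp
  have "u \<notin> H"
  proof
    assume uH: "u \<in> H"
    have "point_weight \<B> [x, a] u \<le> n / 8"
      using upper[of u] u card_blocks_point[OF H_in uH]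
        card_blocks_same_group[OF H_in uH assms(2)] by auto
    then show False using large by simp
  qed
  moreover have "u \<notin> K"
  proof
    assume uK: "u \<in> K"
    have "point_weight \<B> [x, a] u \<le> n / 8"
      using upper[of u] card_blocks_point[OF K_in uK]
        card_blocks_two[OF K_in H_in _ uK assms(2)] card_blocks_two[OF K_in G_in _ uK assms(3)]
        groups_distinct by auto
    then show False using large by simp
  qed
  ultimately show "\<sigma> [x, a] \<in> G - {a}" using u X_eq unfolding u_def by auto
qed

section \<open>Forced moves along the Hamiltonian cycle\<close>

text \<open>The map advances two edges along the cycle, by \<open>b\<close> from \<open>H\<close> to
  \<open>K\<close> and by \<open>a\<close> back. If \<open>R\<close> is closed under it, then
  \<open>R\<close> together with its \<open>b\<close>-mates is closed under adjacency, hence is the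
  whole cycle.\<close>

lemma closed_rows_exhaust:
  assumes cyc: "single_cycle (X - G) (link_edges \<B> a \<union> link_edges \<B> b)"
    and ab: "a \<in> G" "b \<in> G" and R: "R \<subseteq> H" "R \<noteq> {}"
    and closed: "(\<lambda>y. mateH a (mateK b y)) ` R \<subseteq> R"
  shows "K \<subseteq> mateK b ` R"
proof -
  let ?p = "\<lambda>y. mateH a (mateK b y)"
  have fin: "finite R" using R group_sub[OF H_in] finite_X finite_subset by metis
  have "inj_on ?p R"
    using R ab by (intro inj_onI) (metis mateH_mateK mateK_mateH mateK(1) subsetD)
  \<comment> \<open>Edges are undirected, so backward steps must be controlled too: the
    \<open>a\<close>-mate of a point of \<open>R\<close> is the \<open>b\<close>-mate of its
    preimage under \<open>?p\<close>, which again lies in \<open>R\<close>.\<close>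
  then have surj: "?p ` R = R" using closed fin by (metis endo_inj_surj)
  have XG: "X - G = H \<union> K" using X_eq groups_disjoint by blast
  have edge: "u \<in> H \<and> v \<in> K \<and> v = mateK x u \<and> u = mateH x v \<or>
      u \<in> K \<and> v \<in> H \<and> v = mateH x u \<and> u = mateK x v"
    if e: "{u, v} \<in> link_edges \<B> x" and x: "x \<in> G" for u v x
  proof -
    obtain u' v' where uv: "{u, v} = {u', v'}" "{x, u', v'} \<in> \<B>"
      using e unfolding link_edges_def by blast
    then have blk: "{x, u, v} \<in> \<B>" by simp
    obtain g y z where c: "g \<in> G" "y \<in> H" "z \<in> K" "{x, u, v} = {g, y, z}"
      using block_cases[OF blk] .
    then have "y = u \<and> z = v \<or> y = v \<and> z = u"
      using x groups_disjoint by (metis disjoint_iff insertE insertI1 insertI2 singletonD)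
    moreover have "{x, v, u} \<in> \<B>" using blk by (simp add: insert_commute)
    ultimately show ?thesis using blk c x mateK(3) mateH(3) by metis
  qed
  have "R \<union> mateK b ` R = X - G"
  proof (rule single_cycle_closed[OF cyc])
    show "R \<union> mateK b ` R \<subseteq> X - G" using XG R ab mateK(1) by auto
    show "R \<union> mateK b ` R \<noteq> {}" using R by simp
    fix u v assume u: "u \<in> R \<union> mateK b ` R"
      and "{u, v} \<in> link_edges \<B> a \<union> link_edges \<B> b"
    then consider "{u, v} \<in> link_edges \<B> a" | "{u, v} \<in> link_edges \<B> b" by blast
    then show "v \<in> R \<union> mateK b ` R"
    proof cases
      case 1
      from edge[OF 1 ab(1)] show ?thesis
      proof (elim disjE conjE)
        assume uv: "u \<in> H" "v \<in> K" "v = mateK a u"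
        then have "u \<in> R" using u R ab mateK(1) groups_disjoint by blast
        then obtain r where "r \<in> R" "u = ?p r" using surj by blast
        then have "v = mateK b r" using uv(3) ab R mateK(1) mateK_mateH by (metis subsetD)
        then show ?thesis using \<open>r \<in> R\<close> by blast
      next
        assume uv: "u \<in> K" "v = mateH a u"
        then have "u \<in> mateK b ` R" using u R groups_disjoint by blast
        then show ?thesis using uv(2) closed by blast
      qed
    next
      case 2
      from edge[OF 2 ab(2)] show ?thesis
      proof (elim disjE conjE)
        assume uv: "u \<in> H" "v \<in> K" "v = mateK b u"
        then have "u \<in> R" using u R ab mateK(1) groups_disjoint by blast
        then show ?thesis using uv by blast
      next
        assume uv: "u \<in> K" "v = mateH b u"
        then have "u \<in> mateK b ` R" using u R groups_disjoint by blast
        then show ?thesis using uv(2) ab R mateH_mateK by auto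
      qed
    qed
  qed
  then show ?thesis using XG R groups_disjoint by blast
qed

text \<open>A player without points in some group cannot have completed a block, since blocks meet
  all groups.\<close>

lemma not_game_over:
  assumes "chosen Xeno h \<inter> K = {}" "chosen Ophelia h \<inter> H = {}" "u \<in> X - set h"
  shows "\<not> game_over X \<B> h"
proof -
  have "\<not> completed \<B> Xeno h" "\<not> completed \<B> Ophelia h"
    using block_meets[OF _ K_in] block_meets[OF _ H_in] assms
    unfolding completed_def by (metis disjoint_iff subsetD)+
  then show ?thesis using assms(3) unfolding game_over_def by blast
qed

text \<open>After the opening, weights cease to matter: with no win of one's own and a single
  opposing threat, the rule leaves exactly one move and no tie.\<close>

lemma forced_block:
  assumes "score_optimizing X \<B> p s" "ongoing X \<B> h" "to_move h = p"
    and "\<And>w. \<not> completing_point X \<B> p h w"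
    and "completing_point X \<B> (opponent p) h v"
    and "\<And>w. completing_point X \<B> (opponent p) h w \<Longrightarrow> w = v"
  shows "s h = v"
proof -
  have "score_optimizing_move X \<B> p h (s h)"
    using assms(1-3) unfolding score_optimizing_def by blast
  then have "completing_point X \<B> (opponent p) h (s h)"
    using assms(4,5) unfolding score_optimizing_move_def by (auto split: if_splits)
  then show ?thesis by (rule assms(6))
qed

text \<open>
  The walk along the cycle of \<open>a\<close> and \<open>b\<close>: in the invariant, Xeno has just taken \<open>q\<close>, and
  every earlier point in \<open>R\<close> has already been answered through \<open>b\<close> and continued through \<open>a\<close>.
\<close>

lemma Ophelia_exhausts_K:
  assumes \<sigma>: "score_optimizing X \<B> Xeno \<sigma>" and \<tau>: "score_optimizing X \<B> Ophelia \<tau>"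
    and cyc: "single_cycle (X - G) (link_edges \<B> a \<union> link_edges \<B> b)"
    and ab: "a \<in> G" "b \<in> G" "a \<noteq> b"
    and "play X \<B> \<sigma> \<tau> k = h" "to_move h = Ophelia"
    and "chosen Xeno h = insert b (insert q R)" "chosen Ophelia h = insert a (mateK b ` R)"
    and "R \<subseteq> H" "q \<in> H - R" "(\<lambda>y. mateH a (mateK b y)) ` R \<subseteq> insert q R"
  shows "\<exists>k. K \<subseteq> chosen Ophelia (play X \<B> \<sigma> \<tau> k)"
  using assms(7-)
\<comment> \<open>Each round of two moves adds one point of \<open>H\<close> to \<open>R\<close>,
  which bounds the walk.\<close>
proof (induction "card (H - R)" arbitrary: k h q R rule: less_induct)
  case less
  note h = less.prems
  define f where "f = mateK b"
  define p where "p y = mateH a (f y)" for y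
  let ?R = "insert q R"
  have RH: "?R \<subseteq> H" using h by blast
  have fK: "f y \<in> K" if "y \<in> H" for y using that ab mateK(1) f_def by simp
  have pH: "p y \<in> H" if "y \<in> H" for y using that ab fK mateH(1) p_def by simp
  have f_inj: "y = y'" if "f y = f y'" "y \<in> H" "y' \<in> H" for y y'
    using that ab mateH_mateK unfolding f_def by metis
  have chX: "chosen Xeno h = insert b ?R" and chO: "chosen Ophelia h = insert a (f ` R)"
    using h f_def by auto
  have fR: "f ` R \<subseteq> K" using h fK by blast
  have fq: "f q \<in> X - set h"
  proof -
    have "f q \<in> K" "q \<in> H" "q \<notin> R" using h(6) fK by auto
    moreover from this have "f q \<notin> f ` R" using f_inj h(5) by (metis imageE subsetD)
    moreover have "f q \<notin> H" "f q \<noteq> a" "f q \<noteq> b"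
      using \<open>f q \<in> K\<close> ab groups_disjoint by auto
    ultimately show ?thesis using chX chO RH X_eq unfolding set_eq_chosen by auto
  qed
  have over: "\<not> game_over X \<B> h"
    by (rule not_game_over[OF _ _ fq]) (use chX chO RH fR ab groups_disjoint in auto)
  have "ongoing X \<B> h"
    using play_legal[OF \<sigma> \<tau>, of k] over h(1) unfolding ongoing_def by simp
  then have "\<tau> h = f q"
  proof (rule forced_block[OF \<tau> _ h(2)])
    \<comment> \<open>The points that would complete her blocks are the successors of
      \<open>R\<close>, and by the invariant Xeno holds them all.\<close>
    show "\<not> completing_point X \<B> Ophelia h w" for w
      using completing_Ophelia[OF chO ab(1) fR] h(7) chX
      unfolding set_eq_chosen f_def by (auto simp: image_image)
    show "completing_point X \<B> (opponent Ophelia) h (f q)"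
      using completing_Xeno[OF chX ab(2) RH] fq f_def by simp
    \<comment> \<open>Xeno's threats through points of \<open>R\<close> were answered earlier; only
      the one through \<open>q\<close> is open.\<close>
    show "w = f q" if "completing_point X \<B> (opponent Ophelia) h w" for w
      using completing_Xeno[OF chX ab(2) RH] that chO
      unfolding set_eq_chosen f_def by auto
  qed
  then have play1: "play X \<B> \<sigma> \<tau> (Suc k) = h @ [f q]"
    using play_SucI[OF h(1) over] h(2) by simp
  define h1 where "h1 = h @ [f q]"
  have mv1: "to_move h1 = Xeno" using h(2) by (simp add: h1_def)
  have chX1: "chosen Xeno h1 = insert b ?R" and chO1: "chosen Ophelia h1 = insert a (f ` ?R)"
    using chX chO h(2) by (auto simp: h1_def chosen_append)
  have fR1: "f ` ?R \<subseteq> K" using RH fK by blast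
  show ?case
  \<comment> \<open>Either the walk has closed up, and Ophelia's answers already fill
    \<open>K\<close>, or \<open>p q\<close> is free and is her only threat, which Xeno must block
    because all his own threats are answered.\<close>
  proof (cases "p q \<in> ?R")
    case True
    then have "K \<subseteq> mateK b ` ?R"
      using closed_rows_exhaust[OF cyc ab(1,2) RH] h(7) unfolding p_def f_def by auto
    then have "K \<subseteq> chosen Ophelia (play X \<B> \<sigma> \<tau> (Suc k))"
      using chO1 play1 unfolding f_def h1_def by auto
    then show ?thesis by blast
  next
    case False
    have pq: "p q \<in> X - set h1"
    proof -
      have "p q \<in> H" using pH RH by blast
      moreover have "p q \<notin> f ` ?R" "p q \<noteq> a" "p q \<noteq> b"
        using \<open>p q \<in> H\<close> fR1 ab groups_disjoint by auto
      ultimately show ?thesis using chX1 chO1 False X_eq unfolding set_eq_chosen by auto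
    qed
    have over1: "\<not> game_over X \<B> h1"
      by (rule not_game_over[OF _ _ pq]) (use chX1 chO1 RH fR1 ab groups_disjoint in auto)
    have "ongoing X \<B> h1"
      using play_legal[OF \<sigma> \<tau>, of "Suc k"] over1 play1 unfolding ongoing_def h1_def by simp
    then have "\<sigma> h1 = p q"
    proof (rule forced_block[OF \<sigma> _ mv1])
      show "\<not> completing_point X \<B> Xeno h1 w" for w
        using completing_Xeno[OF chX1 ab(2) RH] chO1
        unfolding set_eq_chosen f_def by auto
      show "completing_point X \<B> (opponent Xeno) h1 (p q)"
        using completing_Ophelia[OF chO1 ab(1) fR1] pq p_def by simp
      show "w = p q" if "completing_point X \<B> (opponent Xeno) h1 w" for w
        using completing_Ophelia[OF chO1 ab(1) fR1] that chX1 h(7)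
        unfolding set_eq_chosen p_def f_def by auto
    qed
    then have play2: "play X \<B> \<sigma> \<tau> (Suc (Suc k)) = h1 @ [p q]"
      by (intro play_SucI[OF play1[folded h1_def] over1]) (simp add: mv1)
    have "finite H" using finite_X X_eq by simp
    then have "card (H - ?R) < card (H - R)"
      using h by (intro psubset_card_mono) auto
    then show ?thesis
    proof (rule less.hyps[OF _ play2])
      show "to_move (h1 @ [p q]) = Ophelia" using mv1 by simp
      show "chosen Xeno (h1 @ [p q]) = insert b (insert (p q) ?R)"
        using chX1 mv1 by (auto simp: chosen_append)
      show "chosen Ophelia (h1 @ [p q]) = insert a (mateK b ` ?R)"
        using chO1 mv1 f_def by (auto simp: chosen_append)
      show "?R \<subseteq> H" by (rule RH)
      show "p q \<in> H - ?R" using False pH RH by blast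
      show "(\<lambda>y. mateH a (mateK b y)) ` ?R \<subseteq> insert (p q) ?R"
        using h(7) unfolding p_def f_def by auto
    qed
  qed
qed

text \<open>\<open>K\<close> meets every block. A supposed win and the exhaustion of
  \<open>K\<close> may occur at different stages; as chosen sets only grow, both are compared at the
  later one.\<close>

lemma Xeno_cannot_win_without_K:
  assumes "score_optimizing X \<B> Xeno \<sigma>" "score_optimizing X \<B> Ophelia \<tau>"
    and "K \<subseteq> chosen Ophelia (play X \<B> \<sigma> \<tau> k)"
  shows "\<not> wins X \<B> Xeno \<sigma> \<tau>"
proof
  assume "wins X \<B> Xeno \<sigma> \<tau>"
  then obtain j b where b: "b \<in> \<B>" "b \<subseteq> chosen Xeno (play X \<B> \<sigma> \<tau> j)"
    unfolding wins_def completed_def by blast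
  define h where "h = play X \<B> \<sigma> \<tau> (max j k)"
  have "b \<subseteq> chosen Xeno h" "K \<subseteq> chosen Ophelia h"
    using b(2) assms(3) chosen_play_mono[of j "max j k"] chosen_play_mono[of k "max j k"]
    unfolding h_def by (meson max.cobounded1 max.cobounded2 subset_trans)+
  moreover obtain z where "z \<in> b" "z \<in> K" using block_meets[OF b(1) K_in] .
  ultimately show False
    using chosen_disjoint[of h] play_legal[OF assms(1,2), of "max j k"] unfolding h_def by blast
qed

end

section \<open>Joining the opening to the walk\<close>

theorem theorem3p8:
  fixes n :: nat and X :: "'a set" and \<G> \<B> :: "'a set set"
  assumes "n \<ge> 4"
    and "transversal_design3 n X \<G> \<B>"
    and "atomic X \<G> \<B>"
  shows "\<exists>\<tau>. score_optimizing X \<B> Ophelia \<tau> \<and>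
           (\<forall>\<sigma>. score_optimizing X \<B> Xeno \<sigma> \<longrightarrow> \<not> wins X \<B> Xeno \<sigma> \<tau>)"
proof -
  interpret design3 n X \<G> \<B> using assms by unfold_locales auto
  obtain \<tau> where \<tau>: "score_optimizing X \<B> Ophelia \<tau>"
    using score_optimizing_exists[OF finite_X] by blast
  have "\<not> wins X \<B> Xeno \<sigma> \<tau>" if \<sigma>: "score_optimizing X \<B> Xeno \<sigma>" for \<sigma>
  proof -
    define x where "x = \<sigma> []"
    have "X \<noteq> {}" using assms unfolding transversal_design3_def by auto
    then have over0: "\<not> game_over X \<B> []"
      using not_completed_few[of _ "[]"] unfolding game_over_def by auto
    then have p1: "play X \<B> \<sigma> \<tau> (Suc 0) = [x]"
      using play_SucI[of X \<B> \<sigma> \<tau> 0 "[]"] unfolding x_def to_move_def by simp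
    then have "x \<in> X" using play_legal[OF \<sigma> \<tau>, of "Suc 0"] by simp
    then obtain H where H: "H \<in> \<G>" "x \<in> H"
      using partition unfolding partition_on_def by blast
    define a where "a = \<tau> [x]"
    have a: "a \<in> X - H" and og1: "ongoing X \<B> [x]"
      using first_reply_other_group[OF \<tau> H] unfolding a_def by auto
    have p2: "play X \<B> \<sigma> \<tau> (Suc (Suc 0)) = [x, a]"
      using play_SucI[OF p1] og1 unfolding ongoing_def a_def to_move_def by simp
    obtain G where G: "G \<in> \<G>" "a \<in> G"
      using a partition unfolding partition_on_def by blast
    have "G \<noteq> H" using G a by blast
    \<comment> \<open>The play has now fixed \<open>H\<close> and \<open>G\<close>; \<open>K\<close>
      is the one remaining group.\<close>
    have "card (\<G> - {G, H}) = 1"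
      using card_groups G H \<open>G \<noteq> H\<close> by (simp add: card_Diff_subset)
    then obtain K where "\<G> - {G, H} = {K}" by (rule card_1_singletonE)
    then have K: "\<G> = {G, H, K}" "K \<noteq> G" "K \<noteq> H" using G H by auto
    interpret groups3 n X \<G> \<B> G H K
      using K \<open>G \<noteq> H\<close> by unfold_locales auto
    define b where "b = \<sigma> [x, a]"
    have b: "b \<in> G" "b \<noteq> a" and og2: "ongoing X \<B> [x, a]"
      using second_move_same_group[OF \<sigma> H(2) G(2)] assms(1) unfolding b_def by auto
    have p3: "play X \<B> \<sigma> \<tau> (Suc (Suc (Suc 0))) = [x, a, b]"
      using play_SucI[OF p2] og2 unfolding ongoing_def b_def to_move_def by simp
    \<comment> \<open>Written to match the invariant of \<open>Ophelia_exhausts_K\<close> at its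
      start, with \<open>q\<close> equal to \<open>x\<close> and \<open>R\<close> empty, so that the
      condition on successors is vacuous.\<close>
    have ch: "chosen Xeno [x, a, b] = insert b (insert x {})"
      "chosen Ophelia [x, a, b] = insert a (mateK b ` {})"
      using chosen_append[of _ "[x, a]" b] chosen_append[of _ "[x]" a] chosen_append[of _ "[]" x]
      by (auto simp: to_move_def)
    have "single_cycle (X - G) (link_edges \<B> a \<union> link_edges \<B> b)"
      using assms(3) G b unfolding atomic_def pan_Hamiltonian_def by metis
    from Ophelia_exhausts_K[OF \<sigma> \<tau> this G(2) b(1) _ p3 _ ch] b(2) H(2)
    obtain k where "K \<subseteq> chosen Ophelia (play X \<B> \<sigma> \<tau> k)"
      by (auto simp: to_move_def)
    then show ?thesis by (rule Xeno_cannot_win_without_K[OF \<sigma> \<tau>])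
  qed
  then show ?thesis using \<tau> by blast
qed

end
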